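(* Let $\gamma>0$ and let the reward function be $r(u)=\frac12\ln(1+\gamma u)$. For $p\in(0,1)$ and $x\ge0$ let \[ \omega_{\mathrm{AWGN}}(x)=\frac1\gamma\left[\frac{p(\gamma x+\tilde M)}{1-(1-p)^{\tilde M}}-1\right], \] where $\tilde M=\tilde M_x$ is the least positive integer satisfying $[1+p(\gamma x+\tilde M)](1-p)^{\tilde M}<1$, and let $\varphi(x)=px$ (the fixed fraction policy). Then \[ \underline{F}(\omega_{\mathrm{AWGN}})\ge 1-\mathrm{e}^{-1}\qquad\text{while}\qquad \underline{F}(\varphi)=\frac12 . \]
   Context: Energy harvesting model: a battery has capacity $c>0$. The energy arriving at time $t=1,2,\dots$ is $x_t\ge0$. An online power control policy $\pi^\infty=(\pi_t)_{t\ge1}$ is a sequence of (measurable) maps giving the energy consumed in slot $t$, $u_t=\pi_t(x_1,\dots,x_t)\ge 0$. The battery levels before and after the arrival $x_t$ are $b_{t^-}$ and $b_t$, with $b_{1^-}=0$, $b_t=\min(b_{t^-}+x_t,c)$, $b_{(t+1)^-}=b_t-u_t$. The policy is admissible if $u_t\le b_t$ for all arrival sequences in $[0,\infty)^\infty$ and all $t$; $\Pi$ is the set of admissible policies (for capacity $c$). A stationary policy is a map $\sigma:[0,c]\to[0,c]$ with $\sigma(x)\le x$, identified with the admissible policy $u_t=\sigma(b_t)$. A map $\sigma:[0,\infty)\to[0,\infty)$ with $\sigma(x)\le x$ is regarded as a stationary policy for capacity $c$ via its restriction to $[0,c]$. For arrivals i.i.d. with law $Q$, $\mathcal{T}(\pi^\infty,Q^{\otimes\infty}):=\liminf_{n\to\infty}\mathbb{E}\big[\frac1n\sum_{t=1}^n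 r(U_t)\big]$, where $U_t$ is the energy consumed at time $t$ under $\pi^\infty$. For $p\in(0,1)$, $\mathcal{Q}_{c,p}$ is the set of Borel probability measures $Q$ on $[0,c]$ with $\frac1c\int x\,\mathrm{d}Q=p$. The multiplicative factor of $\pi^\infty\in\Pi$ for $Q$ is $F(\pi^\infty,Q):=\mathcal{T}(\pi^\infty,Q^{\otimes\infty})/\sup_{\hat\pi^\infty\in\Pi}\mathcal{T}(\hat\pi^\infty,Q^{\otimes\infty})$. For a policy $\pi^\infty=\pi^\infty_{c,p}$ parametrized by $(c,p)$, its lower multiplicative factor is $\underline F(\pi^\infty):=\inf_{c>0,\;0<p<1}\ \inf_{Q\in\mathcal{Q}_{c,p}}F(\pi^\infty_{c,p},Q)$. *)

theory Defs
  imports "HOL-Probability.Probability"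
begin

text \<open>
  Time slots are numbered from 0, so slot \<open>t\<close> here is slot \<open>t + 1\<close> in the usual numbering
  from 1. The map \<open>\<pi> t\<close> of a policy lives on the product space over \<open>{..t}\<close>; it is always applied
  to the restriction of an arrival sequence to \<open>{..t}\<close>, which enforces causality.
\<close>

type_synonym policy = "nat \<Rightarrow> (nat \<Rightarrow> real) \<Rightarrow> real"

definition consumed :: "policy \<Rightarrow> (nat \<Rightarrow> real) \<Rightarrow> nat \<Rightarrow> real" where
  "consumed \<pi> x t = \<pi> t (restrict x {..t})"

primrec battery_before :: "real \<Rightarrow> policy \<Rightarrow> (nat \<Rightarrow> real) \<Rightarrow> nat \<Rightarrow> real" where
  "battery_before c \<pi> x 0 = 0"
| "battery_before c \<pi> x (Suc t) = min (battery_before c \<pi> x t + x t) c - consumed \<pi> x t"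

definition battery :: "real \<Rightarrow> policy \<Rightarrow> (nat \<Rightarrow> real) \<Rightarrow> nat \<Rightarrow> real" where
  "battery c \<pi> x t = min (battery_before c \<pi> x t + x t) c"

definition admissible_policies :: "real \<Rightarrow> policy set" where
  "admissible_policies c =
     {\<pi>. (\<forall>t. \<pi> t \<in> borel_measurable (Pi\<^sub>M {..t} (\<lambda>_. restrict_space borel {0..}))) \<and>
         (\<forall>x. (\<forall>t. 0 \<le> x t) \<longrightarrow> (\<forall>t. 0 \<le> consumed \<pi> x t \<and> consumed \<pi> x t \<le> battery c \<pi> x t))}"

text \<open>
  A stationary policy prescribes \<open>u\<^sub>t = \<sigma> (b\<^sub>t)\<close>. As a policy it has to be a function of the
  arrivals, so the battery level it produces is computed from the arrivals by recursion; the lemma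
  below confirms that this is the level given by the general dynamics.
\<close>

primrec stationary_battery :: "real \<Rightarrow> (real \<Rightarrow> real) \<Rightarrow> (nat \<Rightarrow> real) \<Rightarrow> nat \<Rightarrow> real" where
  "stationary_battery c \<sigma> x 0 = min (x 0) c"
| "stationary_battery c \<sigma> x (Suc t) =
     min (stationary_battery c \<sigma> x t - \<sigma> (stationary_battery c \<sigma> x t) + x (Suc t)) c"

definition stationary_policy :: "real \<Rightarrow> (real \<Rightarrow> real) \<Rightarrow> policy" where
  "stationary_policy c \<sigma> t x = \<sigma> (stationary_battery c \<sigma> x t)"

lemma stationary_battery_cong:
  "(\<And>i. i \<le> t \<Longrightarrow> x i = y i) \<Longrightarrow> stationary_battery c \<sigma> x t = stationary_battery c \<sigma> y t"
  by (induction t) auto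

lemma consumed_stationary_policy:
  "consumed (stationary_policy c \<sigma>) x t = \<sigma> (stationary_battery c \<sigma> x t)"
  unfolding consumed_def stationary_policy_def
  by (rule arg_cong[of _ _ \<sigma>], rule stationary_battery_cong) simp

lemma battery_stationary_policy:
  "battery c (stationary_policy c \<sigma>) x t = stationary_battery c \<sigma> x t"
  by (induction t) (simp_all add: battery_def consumed_stationary_policy)

text \<open>
  The limit inferior is taken in the extended reals so that it, and the suprema and infima below,
  are total. For admissible policies and the reward used here all these quantities are finite.
\<close>

definition throughput :: "(real \<Rightarrow> real) \<Rightarrow> policy \<Rightarrow> real measure \<Rightarrow> ereal" where
  "throughput r \<pi> Q =
     liminf (\<lambda>n. ereal (\<integral>x. (1 / real n) * (\<Sum>t<n. r (consumed \<pi> x t)) \<partial>(Pi\<^sub>M UNIV (\<lambda>_. Q))))"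

definition arrival_laws :: "real \<Rightarrow> real \<Rightarrow> real measure set" where
  "arrival_laws c p =
     {Q. prob_space Q \<and> sets Q = sets (restrict_space borel {0..c}) \<and> (1 / c) * (\<integral>x. x \<partial>Q) = p}"

definition mult_factor :: "(real \<Rightarrow> real) \<Rightarrow> real \<Rightarrow> policy \<Rightarrow> real measure \<Rightarrow> ereal" where
  "mult_factor r c \<pi> Q =
     throughput r \<pi> Q / (SUP \<pi>'\<in>admissible_policies c. throughput r \<pi>' Q)"

definition lower_mult_factor :: "(real \<Rightarrow> real) \<Rightarrow> (real \<Rightarrow> real \<Rightarrow> policy) \<Rightarrow> ereal" where
  "lower_mult_factor r \<pi> =
     (INF (c, p)\<in>{0<..} \<times> {0<..<1}. INF Q\<in>arrival_laws c p. mult_factor r c (\<pi> c p) Q)"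

definition awgn_reward :: "real \<Rightarrow> real \<Rightarrow> real" where
  "awgn_reward \<gamma> u = 1 / 2 * ln (1 + \<gamma> * u)"

definition awgn_M :: "real \<Rightarrow> real \<Rightarrow> real \<Rightarrow> nat" where
  "awgn_M \<gamma> p x = (LEAST M. 0 < M \<and> (1 + p * (\<gamma> * x + real M)) * (1 - p) ^ M < 1)"

definition omega_awgn :: "real \<Rightarrow> real \<Rightarrow> real \<Rightarrow> real" where
  "omega_awgn \<gamma> p x =
     1 / \<gamma> * (p * (\<gamma> * x + real (awgn_M \<gamma> p x)) / (1 - (1 - p) ^ awgn_M \<gamma> p x) - 1)"

definition fixed_fraction :: "real \<Rightarrow> real \<Rightarrow> real" where
  "fixed_fraction p x = p * x"

end

theory Submission
  imports Defs "HOL-Real_Asymp.Real_Asymp"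
begin

text \<open>
  Every admissible policy has throughput at most \<open>r (p * c)\<close>, by the tangent to \<open>r\<close> at \<open>p * c\<close> and
  energy conservation. For a stationary policy \<open>\<sigma>\<close>, let \<open>h\<close> be concave and nondecreasing. On
  \<open>[0, c]\<close> the function \<open>x \<mapsto> h (min (y + x) c)\<close> lies above its chord, so an arrival of mean \<open>p * c\<close>
  gives \<open>h\<close> an expected value of at least \<open>(1 - p) * h y + p * h c\<close>, the value for Bernoulli
  arrivals. Hence a Bellman inequality for Bernoulli arrivals bounds the throughput for all laws.

  For the fixed fraction policy a linear \<open>h\<close> gives the factor \<open>1 / (2 - p)\<close>; Bernoulli arrivals with
  \<open>c = p \<rightarrow> 0\<close>, compared with spending everything at once, show that the infimum \<open>1 / 2\<close> is right.
  For \<open>omega_awgn\<close>, \<open>h\<close> is the optimal value of a budget when slot \<open>i\<close> has weight \<open>(1 - p)\<^sup>i\<close>: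
  \<open>omega_awgn\<close> is the first step of the water-filling solution, and spending \<open>p * c\<close> for \<open>1 / p\<close>
  slots shows \<open>p * h c \<ge> (1 - exp (-1)) * r (p * c)\<close>.
\<close>

section \<open>Expectations over i.i.d. arrivals\<close>

locale energy_arrivals =
  fixes c p :: real and Q :: "real measure"
  assumes c_pos: "0 < c" and law: "Q \<in> arrival_laws c p"
begin

abbreviation paths :: "(nat \<Rightarrow> real) measure" where
  "paths \<equiv> Pi\<^sub>M UNIV (\<lambda>_. Q)"

lemma sets_Q: "sets Q = sets (restrict_space borel {0..c})"
  using law by (simp add: arrival_laws_def)

lemma space_Q: "space Q = {0..c}"
  using sets_eq_imp_space_eq[OF sets_Q] by (simp add: space_restrict_space)

sublocale arrival: prob_space Q
  using law by (simp add: arrival_laws_def)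

sublocale path: product_prob_space "\<lambda>_::nat. Q" UNIV
  by unfold_locales

lemma path_in: "x \<in> space paths \<Longrightarrow> x t \<in> {0..c}"
  by (auto simp: space_PiM space_Q PiE_def Pi_def)

lemma borel_measurable_Q:
  fixes f :: "real \<Rightarrow> real"
  shows "f \<in> borel_measurable borel \<Longrightarrow> f \<in> borel_measurable Q"
  using measurable_restrict_space1 measurable_cong_sets[OF sets_Q refl] by blast

lemma borel_measurable_coordinate:
  "t \<in> I \<Longrightarrow> (\<lambda>x. x t) \<in> borel_measurable (Pi\<^sub>M I (\<lambda>_. Q))"
  by (rule measurable_compose[OF measurable_component_singleton[of t I "\<lambda>_. Q"]
        borel_measurable_Q[of "\<lambda>y. y"]]) auto

lemma integrable_bounded:
  fixes f :: "(nat \<Rightarrow> real) \<Rightarrow> real"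
  assumes "f \<in> borel_measurable paths" "\<And>x. x \<in> space paths \<Longrightarrow> \<bar>f x\<bar> \<le> B"
  shows "integrable paths f"
  using assms by (intro path.integrable_const_bound[where B = B] AE_I2) auto

lemma integral_coordinate:
  fixes f :: "real \<Rightarrow> real"
  assumes "f \<in> borel_measurable borel"
  shows "(\<integral>x. f (x t) \<partial>paths) = (\<integral>y. f y \<partial>Q)"
proof -
  have "(\<integral>y. f y \<partial>Q) = (\<integral>y. f y \<partial>distr paths Q (\<lambda>x. x t))"
    using path.PiM_component[of t] by simp
  also have "\<dots> = (\<integral>x. f (x t) \<partial>paths)"
    by (rule integral_distr[OF _ borel_measurable_Q[OF assms]]) simp
  finally show ?thesis by simp
qed

lemma mean_arrival: "(\<integral>x. x t \<partial>paths) = p * c"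
  using integral_coordinate[of "\<lambda>y. y" t] law c_pos
  by (simp add: arrival_laws_def field_simps)

lemma integrable_arrival: "integrable paths (\<lambda>x. x t)"
  by (rule integrable_bounded[where B = c]) (use path_in in \<open>force intro: borel_measurable_coordinate\<close>)+

text \<open>The identity on paths has the product measure as its law, and independence is
  characterised by exactly this form of the joint law.\<close>

lemma indep_coordinates: "path.indep_vars (\<lambda>_. Q) (\<lambda>t x. x t) UNIV"
proof -
  have "distr paths paths (\<lambda>x. \<lambda>i\<in>UNIV. x i) = paths"
    by (simp add: restrict_UNIV distr_id)
  then show ?thesis
    by (subst path.indep_vars_iff_distr_eq_PiM) (auto simp: path.PiM_component)
qed

lemma borel_measurable_stationary_battery:
  assumes "\<sigma> \<in> borel_measurable borel" "{..t} \<subseteq> I"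
  shows "(\<lambda>x. stationary_battery c \<sigma> x t) \<in> borel_measurable (Pi\<^sub>M I (\<lambda>_. Q))"
  using assms(2)
proof (induction t)
  case 0
  then show ?case
    using borel_measurable_coordinate[of 0 I] by simp
next
  case (Suc t)
  then have "(\<lambda>x. stationary_battery c \<sigma> x t) \<in> borel_measurable (Pi\<^sub>M I (\<lambda>_. Q))"
    "(\<lambda>x. x (Suc t)) \<in> borel_measurable (Pi\<^sub>M I (\<lambda>_. Q))"
    by (auto intro!: Suc.IH borel_measurable_coordinate)
  moreover note assms(1)
  ultimately show ?case by simp
qed

text \<open>The level \<open>b\<^sub>t\<close> is a function of the arrivals up to time \<open>t\<close>, hence independent of the next one.\<close>

lemma expectation_battery_times_next:
  assumes \<sigma>: "\<sigma> \<in> borel_measurable borel" and f: "f \<in> borel_measurable borel"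
    and B: "\<And>x. x \<in> space paths \<Longrightarrow> \<bar>f (stationary_battery c \<sigma> x t)\<bar> \<le> B"
  shows "(\<integral>x. f (stationary_battery c \<sigma> x t) * x (Suc t) \<partial>paths)
    = p * c * (\<integral>x. f (stationary_battery c \<sigma> x t) \<partial>paths)"
proof -
  let ?F = "\<lambda>x. f (stationary_battery c \<sigma> x t)"
  have "path.indep_var (Pi\<^sub>M {..t} (\<lambda>_. Q)) (\<lambda>x. restrict x {..t})
      (Pi\<^sub>M {Suc t} (\<lambda>_. Q)) (\<lambda>x. restrict x {Suc t})"
    using path.indep_var_restrict[OF indep_coordinates, of "{..t}" "{Suc t}"] by simp
  then have "path.indep_var borel (?F \<circ> (\<lambda>x. restrict x {..t}))
      borel ((\<lambda>x. x (Suc t)) \<circ> (\<lambda>x. restrict x {Suc t}))"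
    by (rule path.indep_var_compose)
      (auto intro!: measurable_compose[OF borel_measurable_stationary_battery f]
        borel_measurable_coordinate \<sigma>)
  moreover have "?F \<circ> (\<lambda>x. restrict x {..t}) = ?F"
  proof
    fix x
    have "stationary_battery c \<sigma> (restrict x {..t}) t = stationary_battery c \<sigma> x t"
      by (rule stationary_battery_cong) simp
    then show "(?F \<circ> (\<lambda>x. restrict x {..t})) x = ?F x" by simp
  qed
  ultimately have "path.indep_var borel ?F borel (\<lambda>x. x (Suc t))"
    by (simp add: comp_def)
  moreover have "integrable paths ?F"
    by (intro integrable_bounded[where B = B]
        measurable_compose[OF borel_measurable_stationary_battery f] \<sigma> B) auto
  ultimately have "(\<integral>x. ?F x * x (Suc t) \<partial>paths) = (\<integral>x. ?F x \<partial>paths) * (\<integral>x. x (Suc t) \<partial>paths)"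
    using integrable_arrival by (intro path.indep_var_lebesgue_integral)
  then show ?thesis by (simp add: mean_arrival)
qed

section \<open>Throughput bounds\<close>

lemma stationary_battery_in:
  assumes "\<And>b. b \<in> {0..c} \<Longrightarrow> 0 \<le> \<sigma> b \<and> \<sigma> b \<le> b" "x \<in> space paths"
  shows "stationary_battery c \<sigma> x t \<in> {0..c}"
proof (induction t)
  case 0
  then show ?case using path_in[OF assms(2), of 0] by auto
next
  case (Suc t)
  then show ?case using path_in[OF assms(2), of "Suc t"] assms(1)[OF Suc] c_pos by auto
qed

text \<open>Here \<open>g\<close> is a guaranteed gain and \<open>h\<close> a relative value. In
  \<open>drift\<close> the battery is refilled to \<open>c\<close> with weight \<open>p\<close> and
  receives nothing with weight \<open>1 - p\<close>. Telescoping leaves boundary terms of size at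
  most \<open>2 * B\<close>, which averaging removes.\<close>

lemma throughput_stationary_ge:
  assumes \<sigma>: "\<sigma> \<in> borel_measurable borel"
    and \<sigma>_le: "\<And>b. b \<in> {0..c} \<Longrightarrow> 0 \<le> \<sigma> b \<and> \<sigma> b \<le> b"
    and r: "r \<in> borel_measurable borel" and r_le: "\<And>u. u \<in> {0..c} \<Longrightarrow> \<bar>r u\<bar> \<le> K"
    and h: "mono h" and conc: "concave_on {0..c} h"
    and drift: "\<And>b. b \<in> {0..c} \<Longrightarrow> h b + g \<le> r (\<sigma> b) + (1 - p) * h (b - \<sigma> b) + p * h c"
  shows "ereal g \<le> throughput r (stationary_policy c \<sigma>) Q"
proof -
  define b where "b t x = stationary_battery c \<sigma> x t" for t x
  define B where "B = \<bar>h 0\<bar> + \<bar>h c\<bar>"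
  have hB: "\<bar>h y\<bar> \<le> B" if "y \<in> {0..c}" for y
    using monoD[OF h, of 0 y] monoD[OF h, of y c] that by (auto simp: B_def)
  have hm[measurable]: "h \<in> borel_measurable borel"
    by (rule borel_measurable_mono[OF h])
  note [measurable] = \<sigma> r
  have b_in: "b t x \<in> {0..c}" if "x \<in> space paths" for t x
    using stationary_battery_in[OF \<sigma>_le that] by (simp add: b_def)
  have res_in: "b t x - \<sigma> (b t x) \<in> {0..c}" if "x \<in> space paths" for t x
    using b_in[OF that, of t] \<sigma>_le[OF b_in[OF that, of t]] by auto
  have bm[measurable]: "b t \<in> borel_measurable paths" for t
    unfolding b_def by (rule borel_measurable_stationary_battery[OF \<sigma>]) simp
  have xm[measurable]: "(\<lambda>x. x t) \<in> borel_measurable paths" for t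
    by (rule borel_measurable_coordinate) simp
  have int_h: "integrable paths (\<lambda>x. h (b t x))" for t
    by (rule integrable_bounded[where B = B]) (auto intro: hB b_in)
  have int_y: "integrable paths (\<lambda>x. h (b t x - \<sigma> (b t x)))" for t
    by (rule integrable_bounded[where B = B]) (auto intro!: hB res_in)
  have int_r: "integrable paths (\<lambda>x. r (\<sigma> (b t x)))" for t
  proof (rule integrable_bounded[where B = K])
    show "\<bar>r (\<sigma> (b t x))\<bar> \<le> K" if "x \<in> space paths" for x
      using b_in[OF that, of t] \<sigma>_le[OF b_in[OF that, of t]] by (intro r_le) auto
  qed simp
  \<comment> \<open>The rise of the chord from the level after consumption to \<open>c\<close>.
    Weighted by \<open>x (Suc t) / c\<close> it is linear in the next arrival, so independence
    reduces its expectation to the mean arrival.\<close>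
  let ?f = "\<lambda>y. h c - h (y - \<sigma> y)"
  have fB: "\<bar>?f (b t x)\<bar> \<le> 2 * B" if "x \<in> space paths" for t x
    using hB[OF res_in[OF that], of t] hB[of c] c_pos by (auto simp: abs_if split: if_splits)
  have prod: "(\<integral>x. ?f (b t x) * x (Suc t) \<partial>paths) = p * c * (\<integral>x. ?f (b t x) \<partial>paths)" for t
    unfolding b_def
    by (rule expectation_battery_times_next[OF \<sigma>]) (use fB in \<open>auto simp: b_def\<close>)
  have int_prod: "integrable paths (\<lambda>x. ?f (b t x) * x (Suc t))" for t
  proof (rule integrable_bounded[where B = "2 * B * c"])
    show "\<bar>?f (b t x) * x (Suc t)\<bar> \<le> 2 * B * c" if "x \<in> space paths" for x
      unfolding abs_mult using fB[OF that, of t] path_in[OF that, of "Suc t"]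
      by (intro mult_mono) auto
  qed simp
  \<comment> \<open>The chord point \<open>(1 - s) * y + s * c\<close> lies below both
    \<open>c\<close> and \<open>y + s * c\<close>, hence below the next level; concavity and then
    monotonicity of \<open>h\<close> give the bound.\<close>
  have step: "h (b t x - \<sigma> (b t x)) + ?f (b t x) * x (Suc t) / c \<le> h (b (Suc t) x)"
    if x: "x \<in> space paths" for t x
  proof -
    define y where "y = b t x - \<sigma> (b t x)"
    define s where "s = x (Suc t) / c"
    have y: "y \<in> {0..c}" and s: "0 \<le> s" "s \<le> 1" and xs: "x (Suc t) = s * c"
      using res_in[OF x] path_in[OF x, of "Suc t"] c_pos by (auto simp: y_def s_def)
    have "(1 - s) * h y + s * h c \<le> h ((1 - s) *\<^sub>R y + s *\<^sub>R c)"
      using concave_onD[OF conc s y] c_pos by auto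
    also have "\<dots> \<le> h (b (Suc t) x)"
    proof (rule monoD[OF h])
      have "(1 - s) * y + s * c \<le> c"
        using y s mult_left_mono[of y c "1 - s"] by (auto simp: algebra_simps)
      moreover have "(1 - s) * y \<le> y" using y s by (auto simp: algebra_simps)
      ultimately show "(1 - s) *\<^sub>R y + s *\<^sub>R c \<le> b (Suc t) x"
        using xs by (simp add: b_def y_def)
    qed
    finally show ?thesis
      by (simp add: y_def[symmetric] s_def algebra_simps diff_divide_distrib)
  qed
  have gain: "(\<integral>x. h (b t x) \<partial>paths) + g
      \<le> (\<integral>x. r (\<sigma> (b t x)) \<partial>paths) + (\<integral>x. h (b (Suc t) x) \<partial>paths)" for t
  proof -
    have "(\<integral>x. h (b t x) \<partial>paths) + g = (\<integral>x. h (b t x) + g \<partial>paths)"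
      using int_h by (simp add: path.P.prob_space)
    also have "\<dots> \<le> (\<integral>x. r (\<sigma> (b t x)) + ((1 - p) * h (b t x - \<sigma> (b t x)) + p * h c) \<partial>paths)"
      using int_h int_r int_y drift b_in
      by (intro integral_mono) (auto simp: add.assoc)
    also have "\<dots> = (\<integral>x. r (\<sigma> (b t x)) \<partial>paths)
        + ((\<integral>x. h (b t x - \<sigma> (b t x)) \<partial>paths) + p * (\<integral>x. ?f (b t x) \<partial>paths))"
      using int_r int_y by (simp add: path.P.prob_space algebra_simps)
    also have "(\<integral>x. h (b t x - \<sigma> (b t x)) \<partial>paths) + p * (\<integral>x. ?f (b t x) \<partial>paths)
        = (\<integral>x. h (b t x - \<sigma> (b t x)) + ?f (b t x) * x (Suc t) / c \<partial>paths)"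
      using int_y int_prod prod[of t] c_pos by simp
    also have "\<dots> \<le> (\<integral>x. h (b (Suc t) x) \<partial>paths)"
      using int_h int_y int_prod step by (intro integral_mono) auto
    finally show ?thesis by simp
  qed
  have sum_ge: "n * g - 2 * B \<le> (\<Sum>t<n. \<integral>x. r (\<sigma> (b t x)) \<partial>paths)" for n :: nat
  proof -
    have hE: "\<bar>\<integral>x. h (b t x) \<partial>paths\<bar> \<le> B" for t
    proof -
      have "\<bar>\<integral>x. h (b t x) \<partial>paths\<bar> \<le> (\<integral>x. \<bar>h (b t x)\<bar> \<partial>paths)" by (rule integral_abs_bound)
      also have "\<dots> \<le> (\<integral>x. B \<partial>paths)" using int_h hB b_in by (intro integral_mono) auto
      finally show ?thesis by (simp add: path.P.prob_space)
    qed
    have "(\<integral>x. h (b 0 x) \<partial>paths) + n * g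
        \<le> (\<Sum>t<n. \<integral>x. r (\<sigma> (b t x)) \<partial>paths) + (\<integral>x. h (b n x) \<partial>paths)"
    proof (induction n)
      case (Suc n)
      then show ?case using gain[of n] by (simp add: algebra_simps)
    qed simp
    then show ?thesis using hE[of 0] hE[of n] by (auto simp: abs_le_iff)
  qed
  \<comment> \<open>For \<open>n = 0\<close> both divisions return 0, so the average is 0 while the
    bound is \<open>g\<close>; hence the restriction to positive \<open>n\<close>.\<close>
  have "ereal (g - 2 * B / n)
      \<le> ereal (\<integral>x. 1 / real n * (\<Sum>t<n. r (consumed (stationary_policy c \<sigma>) x t)) \<partial>paths)"
    if "n > 0" for n
  proof -
    have "(\<integral>x. 1 / real n * (\<Sum>t<n. r (consumed (stationary_policy c \<sigma>) x t)) \<partial>paths)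
      = 1 / real n * (\<Sum>t<n. \<integral>x. r (\<sigma> (b t x)) \<partial>paths)"
      using int_r by (simp add: consumed_stationary_policy b_def)
    then show ?thesis
      using divide_right_mono[OF sum_ge[of n], of "real n"] that by (simp add: diff_divide_distrib)
  qed
  then have "liminf (\<lambda>n. ereal (g - 2 * B / n)) \<le> throughput r (stationary_policy c \<sigma>) Q"
    unfolding throughput_def by (intro Liminf_mono eventually_sequentiallyI[of 1]) auto
  moreover have "(\<lambda>n. g - 2 * B / real n) \<longlonglongrightarrow> g" by real_asymp
  then have "liminf (\<lambda>n. ereal (g - 2 * B / n)) = ereal g"
    by (intro lim_imp_Liminf) auto
  ultimately show ?thesis by simp
qed

section \<open>Upper bound for every admissible policy\<close>

lemma borel_measurable_consumed:
  assumes "\<pi> \<in> admissible_policies c"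
  shows "(\<lambda>x. consumed \<pi> x t) \<in> borel_measurable paths"
proof -
  \<comment> \<open>Policies are measurable for arrivals in the half-line, whereas \<open>Q\<close>
    lives on \<open>{0..c}\<close>; the inclusion bridges the two spaces.\<close>
  have "(\<lambda>x. x) \<in> measurable Q (restrict_space borel {0..})"
    by (rule measurable_restrict_space2) (auto simp: space_Q intro: borel_measurable_Q)
  then have "(\<lambda>x. restrict x {..t}) \<in> measurable paths (Pi\<^sub>M {..t} (\<lambda>_. restrict_space borel {0..}))"
    by (intro measurable_restrict) (auto intro: measurable_compose[OF measurable_component_singleton])
  moreover have "\<pi> t \<in> borel_measurable (Pi\<^sub>M {..t} (\<lambda>_. restrict_space borel {0..}))"
    using assms by (simp add: admissible_policies_def)
  ultimately show ?thesis
    unfolding consumed_def by (rule measurable_compose)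
qed

lemma consumed_bounds:
  assumes "\<pi> \<in> admissible_policies c" "x \<in> space paths"
  shows "consumed \<pi> x t \<in> {0..c}"
proof -
  have "\<forall>t. 0 \<le> x t" using path_in[OF assms(2)] by auto
  then have "0 \<le> consumed \<pi> x t \<and> consumed \<pi> x t \<le> battery c \<pi> x t"
    using assms(1) by (auto simp: admissible_policies_def)
  then show ?thesis by (auto simp: battery_def)
qed

text \<open>Energy conservation: the level before a slot is nonnegative by admissibility, and the
  cap at \<open>c\<close> can only discard energy.\<close>

lemma sum_consumed_le:
  assumes "\<pi> \<in> admissible_policies c" "x \<in> space paths"
  shows "(\<Sum>t<n. consumed \<pi> x t) \<le> (\<Sum>t<n. x t)"
proof -
  have "\<forall>t. 0 \<le> x t" using path_in[OF assms(2)] by auto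
  then have "consumed \<pi> x t \<le> battery c \<pi> x t" for t
    using assms(1) by (auto simp: admissible_policies_def)
  then have "0 \<le> battery_before c \<pi> x n"
    by (cases n) (auto simp: battery_def)
  moreover have "battery_before c \<pi> x n + (\<Sum>t<n. consumed \<pi> x t) \<le> (\<Sum>t<n. x t)"
  proof (induction n)
    case (Suc n)
    have "battery_before c \<pi> x (Suc n) \<le> battery_before c \<pi> x n + x n - consumed \<pi> x n"
      by simp
    with Suc show ?case by simp
  qed simp
  ultimately show ?thesis by linarith
qed

text \<open>Summed tangent bounds are linear in the total consumption. Since \<open>a\<close> is
  nonnegative, it may be replaced by the total arrival, whose mean cancels the linear term.\<close>

lemma throughput_le:
  assumes \<pi>: "\<pi> \<in> admissible_policies c"
    and r: "r \<in> borel_measurable borel" and r_le: "\<And>u. u \<in> {0..c} \<Longrightarrow> \<bar>r u\<bar> \<le> K"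
    and a: "0 \<le> a" and tangent: "\<And>u. u \<in> {0..c} \<Longrightarrow> r u \<le> g + a * (u - p * c)"
  shows "throughput r \<pi> Q \<le> ereal g"
proof -
  note [measurable] = borel_measurable_consumed[OF \<pi>] r
  have int_r: "integrable paths (\<lambda>x. r (consumed \<pi> x t))" for t
    by (rule integrable_bounded[where B = K]) (auto intro: r_le consumed_bounds[OF \<pi>])
  have "(\<integral>x. 1 / real n * (\<Sum>t<n. r (consumed \<pi> x t)) \<partial>paths) \<le> g" if n: "n > 0" for n
  proof -
    have "(\<integral>x. (\<Sum>t<n. r (consumed \<pi> x t)) \<partial>paths) \<le> (\<integral>x. n * g + a * ((\<Sum>t<n. x t) - n * (p * c)) \<partial>paths)"
    proof (rule integral_mono)
      fix x assume x: "x \<in> space paths"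
      have "(\<Sum>t<n. r (consumed \<pi> x t)) \<le> (\<Sum>t<n. g + a * (consumed \<pi> x t - p * c))"
        by (intro sum_mono tangent consumed_bounds[OF \<pi> x])
      also have "\<dots> = n * g + a * ((\<Sum>t<n. consumed \<pi> x t) - n * (p * c))"
        by (simp add: sum.distrib sum_subtractf sum_distrib_left[symmetric])
      also have "\<dots> \<le> n * g + a * ((\<Sum>t<n. x t) - n * (p * c))"
        using sum_consumed_le[OF \<pi> x, of n] a by (intro add_left_mono mult_left_mono) auto
      finally show "(\<Sum>t<n. r (consumed \<pi> x t)) \<le> \<dots>" .
    qed (use int_r integrable_arrival in auto)
    also have "\<dots> = n * g"
      using integrable_arrival by (simp add: mean_arrival path.P.prob_space)
    finally show ?thesis using n by (simp add: field_simps)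
  qed
  then have "throughput r \<pi> Q \<le> liminf (\<lambda>n. ereal g)"
    unfolding throughput_def by (intro Liminf_mono eventually_sequentiallyI[of 1]) auto
  then show ?thesis by (simp add: Liminf_const)
qed

end

section \<open>The discounted allocation problem\<close>

text \<open>
  \<open>discounted_value r p b\<close> is the least concave nondecreasing majorant of the optimal value of
  \<open>\<Sum>i. (1 - p)\<^sup>i * r (u i)\<close> over nonnegative \<open>u\<close> with \<open>\<Sum>i. u i \<le> b\<close>. Defining it through affine
  majorants makes concavity, monotonicity and weak duality immediate.
\<close>

definition affine_majorant :: "(real \<Rightarrow> real) \<Rightarrow> real \<Rightarrow> real \<Rightarrow> real \<Rightarrow> bool" where
  "affine_majorant r p a d \<longleftrightarrow> 0 \<le> a \<and>
     (\<forall>N u. (\<forall>i. 0 \<le> u i) \<longrightarrow> (\<Sum>i<N. (1 - p) ^ i * r (u i)) \<le> a * (\<Sum>i<N. u i) + d)"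

definition discounted_value :: "(real \<Rightarrow> real) \<Rightarrow> real \<Rightarrow> real \<Rightarrow> real" where
  "discounted_value r p b = Inf {a * b + d |a d. affine_majorant r p a d}"

lemma discounted_value_le:
  assumes "affine_majorant r p a d" "0 \<le> b"
  shows "discounted_value r p b \<le> a * b + d"
  unfolding discounted_value_def
proof (rule cInf_lower)
  \<comment> \<open>A real \<open>Inf\<close> is a lower bound only for sets bounded below; the
    empty sum forces \<open>d'\<close> to be nonnegative.\<close>
  have "0 \<le> a' * b + d'" if major: "affine_majorant r p a' d'" for a' d'
  proof -
    have a': "0 \<le> a'"
      using major by (simp add: affine_majorant_def)
    have le: "(\<Sum>i<N. (1 - p) ^ i * r (u i)) \<le> a' * (\<Sum>i<N. u i) + d'"
      if "\<forall>i. 0 \<le> u i" for N u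
      using major that unfolding affine_majorant_def by blast
    have "0 \<le> d'" using le[of "\<lambda>_. 0" 0] by simp
    moreover have "0 \<le> a' * b" using a' assms(2) by simp
    ultimately show ?thesis by simp
  qed
  then show "bdd_below {a * b + d |a d. affine_majorant r p a d}"
    by (intro bdd_belowI[of _ 0]) blast
qed (use assms in auto)

text \<open>The assumed majorant makes the set under the infimum nonempty; the same assumption
  recurs below for this reason.\<close>

lemma discounted_value_greatest:
  assumes "affine_majorant r p a d"
    and "\<And>a d. affine_majorant r p a d \<Longrightarrow> z \<le> a * b + d"
  shows "z \<le> discounted_value r p b"
  unfolding discounted_value_def using assms by (intro cInf_greatest) auto

lemma discounted_value_ge:
  assumes "affine_majorant r p a d" and u: "\<And>i. 0 \<le> u i" and le: "(\<Sum>i<N. u i) \<le> b"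
  shows "(\<Sum>i<N. (1 - p) ^ i * r (u i)) \<le> discounted_value r p b"
proof (rule discounted_value_greatest[OF assms(1)])
  fix a d assume *: "affine_majorant r p a d"
  then have "(\<Sum>i<N. (1 - p) ^ i * r (u i)) \<le> a * (\<Sum>i<N. u i) + d"
    using u by (auto simp: affine_majorant_def)
  also have "\<dots> \<le> a * b + d"
    using * le by (intro add_right_mono mult_left_mono) (auto simp: affine_majorant_def)
  finally show "(\<Sum>i<N. (1 - p) ^ i * r (u i)) \<le> a * b + d" .
qed

text \<open>Clamping at 0 gives monotonicity on the whole line, as
  \<open>throughput_stationary_ge\<close> demands of \<open>h\<close>.\<close>

lemma mono_discounted_value:
  assumes "affine_majorant r p a d"
  shows "mono (\<lambda>b. discounted_value r p (max 0 b))"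
proof (rule monoI, rule discounted_value_greatest[OF assms])
  fix x y a d :: real assume "x \<le> y" and *: "affine_majorant r p a d"
  then have "a * max 0 x + d \<le> a * max 0 y + d"
    by (intro add_right_mono mult_left_mono) (auto simp: affine_majorant_def)
  then show "discounted_value r p (max 0 x) \<le> a * max 0 y + d"
    using discounted_value_le[OF *, of "max 0 x"] by simp
qed

lemma concave_discounted_value:
  assumes "affine_majorant r p a d"
  shows "concave_on {0..} (discounted_value r p)"
  unfolding concave_on_iff
proof (intro conjI ballI allI impI discounted_value_greatest[OF assms])
  fix x y s t a d :: real
  assume xy: "x \<in> {0..}" "y \<in> {0..}" and s: "0 \<le> s" "0 \<le> t" "s + t = 1"
    and *: "affine_majorant r p a d"
  have "s * discounted_value r p x + t * discounted_value r p y
      \<le> s * (a * x + d) + t * (a * y + d)"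
    using xy s by (intro add_mono mult_left_mono discounted_value_le[OF *]) auto
  also have "\<dots> = a * (s * x + t * y) + (s + t) * d"
    by (simp add: algebra_simps)
  finally show "s * discounted_value r p x + t * discounted_value r p y
      \<le> a * (s *\<^sub>R x + t *\<^sub>R y) + d"
    using s by simp
qed simp

section \<open>The logarithmic reward\<close>

lemma awgn_reward_0 [simp]: "awgn_reward \<gamma> 0 = 0"
  by (simp add: awgn_reward_def)

lemma borel_measurable_awgn_reward [measurable]: "awgn_reward \<gamma> \<in> borel_measurable borel"
  unfolding awgn_reward_def by measurable

lemma awgn_reward_pos: "0 < \<gamma> \<Longrightarrow> 0 < u \<Longrightarrow> 0 < awgn_reward \<gamma> u"
  by (simp add: awgn_reward_def ln_gt_zero)

lemma awgn_reward_le_tangent: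
  assumes "0 < \<gamma>" "0 \<le> u" "0 \<le> v"
  shows "awgn_reward \<gamma> u \<le> awgn_reward \<gamma> v + \<gamma> / (2 * (1 + \<gamma> * v)) * (u - v)"
proof -
  have pos: "0 < 1 + \<gamma> * u" "0 < 1 + \<gamma> * v" using assms by (auto intro: add_pos_nonneg)
  have "ln (1 + \<gamma> * u) - ln (1 + \<gamma> * v) = ln ((1 + \<gamma> * u) / (1 + \<gamma> * v))"
    using pos by (simp add: ln_div)
  also have "\<dots> \<le> (1 + \<gamma> * u) / (1 + \<gamma> * v) - 1"
    using pos by (intro ln_le_minus_one) simp
  also have "\<dots> = \<gamma> * (u - v) / (1 + \<gamma> * v)"
    using pos by (simp add: field_simps)
  finally have "ln (1 + \<gamma> * u) / 2 \<le> (ln (1 + \<gamma> * v) + \<gamma> * (u - v) / (1 + \<gamma> * v)) / 2"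
    by simp
  then show ?thesis
    unfolding awgn_reward_def add_divide_distrib by (simp only: divide_divide_eq_left) (simp add: mult.commute)
qed

lemma awgn_reward_le_linear: "0 < \<gamma> \<Longrightarrow> 0 \<le> u \<Longrightarrow> awgn_reward \<gamma> u \<le> \<gamma> / 2 * u"
  using awgn_reward_le_tangent[of \<gamma> u 0] by simp

lemma awgn_reward_nonneg: "0 < \<gamma> \<Longrightarrow> 0 \<le> u \<Longrightarrow> 0 \<le> awgn_reward \<gamma> u"
  by (simp add: awgn_reward_def)

lemma awgn_reward_abs_le:
  assumes "0 < \<gamma>" "u \<in> {0..c}"
  shows "\<bar>awgn_reward \<gamma> u\<bar> \<le> \<gamma> / 2 * c"
proof -
  have "\<gamma> / 2 * u \<le> \<gamma> / 2 * c" using assms by (intro mult_left_mono) auto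
  then show ?thesis
    using awgn_reward_le_linear[of \<gamma> u] awgn_reward_nonneg[of \<gamma> u] assms
    unfolding atLeastAtMost_iff by linarith
qed

text \<open>Concavity together with value 0 at 0: the tangent at \<open>s * y\<close> is evaluated
  at \<open>y\<close> and at 0, with weights \<open>s\<close> and \<open>1 - s\<close>.\<close>

lemma awgn_reward_scale:
  assumes \<gamma>: "0 < \<gamma>" and y: "0 \<le> y" and s: "0 \<le> s" "s \<le> 1"
  shows "s * awgn_reward \<gamma> y \<le> awgn_reward \<gamma> (s * y)"
proof -
  define k where "k = \<gamma> / (2 * (1 + \<gamma> * (s * y)))"
  have "s * awgn_reward \<gamma> y \<le> s * (awgn_reward \<gamma> (s * y) + k * (y - s * y))"
    unfolding k_def using assms by (intro mult_left_mono awgn_reward_le_tangent) auto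
  moreover have "(1 - s) * 0 \<le> (1 - s) * (awgn_reward \<gamma> (s * y) + k * (0 - s * y))"
    unfolding k_def using assms awgn_reward_le_tangent[of \<gamma> 0 "s * y"]
    by (intro mult_left_mono) auto
  ultimately show ?thesis by (simp add: algebra_simps)
qed

text \<open>Supplies the majorant that the lemmas on \<open>discounted_value\<close> ask for: the
  tangent at 0, with discount weights at most 1.\<close>

lemma affine_majorant_awgn_reward:
  assumes "0 < \<gamma>" "0 < p" "p < 1"
  shows "affine_majorant (awgn_reward \<gamma>) p (\<gamma> / 2) 0"
  unfolding affine_majorant_def
proof (intro conjI allI impI)
  fix N :: nat and u :: "nat \<Rightarrow> real" assume u: "\<forall>i. 0 \<le> u i"
  have "(\<Sum>i<N. (1 - p) ^ i * awgn_reward \<gamma> (u i)) \<le> (\<Sum>i<N. 1 * (\<gamma> / 2 * u i))"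
    using assms u awgn_reward_le_linear awgn_reward_nonneg
    by (intro sum_mono mult_mono power_le_one) auto
  then show "(\<Sum>i<N. (1 - p) ^ i * awgn_reward \<gamma> (u i)) \<le> \<gamma> / 2 * (\<Sum>i<N. u i) + 0"
    by (simp add: sum_distrib_left)
qed (use assms in simp)

text \<open>
  Spending \<open>p * c\<close> for \<open>1 / p\<close> slots is feasible for the budget \<open>c\<close>; the last of these slots is
  fractional, with fraction \<open>\<theta>\<close>.
\<close>

lemma discounted_value_ge_constant_allocation:
  assumes \<gamma>: "0 < \<gamma>" and p: "0 < p" "p < 1" and c: "0 < c"
  shows "(1 - exp (-1)) * awgn_reward \<gamma> (p * c) \<le> p * discounted_value (awgn_reward \<gamma>) p c"
proof -
  define N where "N = nat \<lfloor>1 / p\<rfloor>"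
  define \<theta> where "\<theta> = 1 / p - N"
  define R where "R = awgn_reward \<gamma> (p * c)"
  define u where "u i = (if i < N then p * c else \<theta> * (p * c))" for i
  have N: "real N = of_int \<lfloor>1 / p\<rfloor>" using p by (simp add: N_def)
  then have \<theta>: "0 \<le> \<theta>" "\<theta> \<le> 1" unfolding \<theta>_def by linarith+
  have p\<theta>: "p * N + p * \<theta> = 1" using p by (simp add: \<theta>_def algebra_simps)
  have R: "0 \<le> R" using assms by (simp add: R_def awgn_reward_nonneg)
  \<comment> \<open>The exponent is split into \<open>N\<close> full slots and the fractional one;
    \<open>1 - z \<le> exp (- z)\<close> is then applied to each factor.\<close>
  have "exp (-1) = exp (- (p * N)) * exp (- (p * \<theta>))"
    using p\<theta> by (simp add: exp_add[symmetric])
  moreover have "(1 - p) ^ N \<le> exp (- (p * N))"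
  proof -
    have "(1 - p) ^ N \<le> exp (- p) ^ N"
      using p exp_ge_add_one_self[of "- p"] by (intro power_mono) auto
    then show ?thesis by (simp add: exp_of_nat_mult[symmetric] mult.commute)
  qed
  moreover have "1 - p * \<theta> \<le> exp (- (p * \<theta>))"
    using exp_ge_add_one_self[of "- (p * \<theta>)"] by simp
  moreover have "1 - p * \<theta> = p * N" using p\<theta> by linarith
  then have "0 \<le> 1 - p * \<theta>" using p by simp
  ultimately have "(1 - p) ^ N * (1 - p * \<theta>) \<le> exp (-1)"
    using mult_mono[of "(1 - p) ^ N" "exp (- (p * N))" "1 - p * \<theta>" "exp (- (p * \<theta>))"]
    by simp
  then have "(1 - exp (-1)) * R \<le> (1 - (1 - p) ^ N * (1 - p * \<theta>)) * R"
    using R by (intro mult_right_mono) auto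
  also have "\<dots> = p * ((\<Sum>i<N. (1 - p) ^ i) * R + (1 - p) ^ N * (\<theta> * R))"
  proof -
    have "p * (\<Sum>i<N. (1 - p) ^ i) = 1 - (1 - p) ^ N"
      using one_diff_power_eq[of "1 - p" N] by simp
    then have "p * ((\<Sum>i<N. (1 - p) ^ i) * R) = (1 - (1 - p) ^ N) * R"
      by (simp add: mult.assoc[symmetric])
    then show ?thesis by (simp add: algebra_simps)
  qed
  also have "\<dots> \<le> p * (\<Sum>i<Suc N. (1 - p) ^ i * awgn_reward \<gamma> (u i))"
    using p c \<gamma> \<theta> awgn_reward_scale[of \<gamma> "p * c" \<theta>]
    by (auto simp: u_def R_def sum_distrib_right intro!: mult_left_mono)
  also have "\<dots> \<le> p * discounted_value (awgn_reward \<gamma>) p c"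
  proof (intro mult_left_mono discounted_value_ge[OF affine_majorant_awgn_reward[OF \<gamma> p]])
    have "(\<Sum>i<Suc N. u i) = (p * N + p * \<theta>) * c" by (simp add: u_def algebra_simps)
    then show "(\<Sum>i<Suc N. u i) \<le> c" by (simp add: p\<theta>)
  qed (use p c \<theta> in \<open>auto simp: u_def\<close>)
  finally show ?thesis by (simp add: R_def)
qed

section \<open>The policy \<open>omega_awgn\<close>\<close>

lemma borel_measurable_omega_awgn: "omega_awgn \<gamma> p \<in> borel_measurable borel"
proof -
  have M [measurable]: "awgn_M \<gamma> p \<in> measurable borel (count_space UNIV)"
    unfolding awgn_M_def by measurable
  have [measurable]: "(\<lambda>x. real (awgn_M \<gamma> p x)) \<in> borel_measurable borel"
    "(\<lambda>x. (1 - p) ^ awgn_M \<gamma> p x) \<in> borel_measurable borel"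
    by (rule measurable_compose[OF M], simp)+
  show ?thesis unfolding omega_awgn_def by measurable
qed

text \<open>
  In water-filling terms \<open>w\<close> is \<open>1 + \<gamma> * u\<^sub>0\<close>, the amount spent in slot \<open>i \<le> m\<close> is
  \<open>(w * (1 - p)\<^sup>i - 1) / \<gamma>\<close>, and nothing is left for later slots.
\<close>

lemma omega_awgn_water_filling:
  fixes \<gamma> p x :: real
  assumes \<gamma>: "0 < \<gamma>" and p: "0 < p" "p < 1" and x: "0 \<le> x"
  obtains m w where "omega_awgn \<gamma> p x = (w - 1) / \<gamma>"
    and "(\<Sum>i<Suc m. w * (1 - p) ^ i - 1) = \<gamma> * x"
    and "w * (1 - p) ^ Suc m < 1" and "\<And>i. i \<le> m \<Longrightarrow> 1 \<le> w * (1 - p) ^ i"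
proof -
  define P where "P M \<longleftrightarrow> 0 < M \<and> (1 + p * (\<gamma> * x + real M)) * (1 - p) ^ M < 1" for M
  define M where "M = awgn_M \<gamma> p x"
  have M_Least: "M = (LEAST M. P M)" by (simp add: M_def awgn_M_def P_def)
  \<comment> \<open>Exponential decay beats linear growth, so the set whose \<open>LEAST\<close>
    element is taken is nonempty.\<close>
  have "(\<lambda>M. (1 + p * (\<gamma> * x + real M)) * (1 - p) ^ M) \<longlonglongrightarrow> 0"
    using p by real_asymp
  then have "\<forall>\<^sub>F M in sequentially. (1 + p * (\<gamma> * x + real M)) * (1 - p) ^ M < 1"
    by (rule order_tendstoD) simp
  with eventually_gt_at_top[of 0] have "\<forall>\<^sub>F M in sequentially. P M"
    by eventually_elim (simp add: P_def)
  then obtain M0 where "P M0" by (auto dest: eventually_happens)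
  then have PM: "P M" unfolding M_Least by (rule LeastI)
  have least: "\<not> P k" if "k < M" for k using that unfolding M_Least by (rule not_less_Least)
  obtain m where m: "M = Suc m" using PM by (cases M) (auto simp: P_def)
  define w where "w = p * (\<gamma> * x + M) / (1 - (1 - p) ^ M)"
  have less: "(1 - p) ^ M < 1" using p m power_Suc_less_one[of "1 - p" m] by auto
  then have w: "w * (1 - (1 - p) ^ M) = p * (\<gamma> * x + M)" by (simp add: w_def)
  have "p * (\<Sum>i<Suc m. w * (1 - p) ^ i - 1) = w * (p * (\<Sum>i<M. (1 - p) ^ i)) - p * M"
    by (simp add: m sum_subtractf sum_distrib_left[symmetric] algebra_simps)
  also have "p * (\<Sum>i<M. (1 - p) ^ i) = 1 - (1 - p) ^ M"
    using one_diff_power_eq[of "1 - p" M] by simp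
  finally have "p * (\<Sum>i<Suc m. w * (1 - p) ^ i - 1) = p * (\<gamma> * x)"
    using w by (simp add: algebra_simps)
  then have 2: "(\<Sum>i<Suc m. w * (1 - p) ^ i - 1) = \<gamma> * x" using p by simp
  have 1: "omega_awgn \<gamma> p x = (w - 1) / \<gamma>" by (simp add: omega_awgn_def w_def M_def)
  \<comment> \<open>Multiplied by the positive number \<open>1 - (1 - p) ^ M\<close>, the claim
    \<open>w * (1 - p) ^ M < 1\<close> becomes \<open>P M\<close> rearranged.\<close>
  have "w * (1 - p) ^ M * (1 - (1 - p) ^ M) = p * (\<gamma> * x + M) * (1 - p) ^ M"
    using w by (simp add: mult_ac)
  also have "\<dots> < 1 * (1 - (1 - p) ^ M)" using PM by (simp add: P_def algebra_simps)
  finally have 3: "w * (1 - p) ^ Suc m < 1" using less m by simp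
  have wm: "1 \<le> w * (1 - p) ^ m"
  \<comment> \<open>Minimality of \<open>M\<close> says nothing about 0, since \<open>P\<close>
    demands a positive argument; there the budget equation gives the claim directly. Otherwise the
    failure of \<open>P m\<close> is the claim multiplied by
    \<open>1 - (1 - p) ^ Suc m\<close>.\<close>
  proof (cases "m = 0")
    case True
    then have "w - 1 = \<gamma> * x" using 2 by simp
    moreover have "0 \<le> \<gamma> * x" using \<gamma> x by simp
    ultimately have "1 \<le> w" by linarith
    then show ?thesis using True by simp
  next
    case False
    then have "1 \<le> (1 + p * (\<gamma> * x + real m)) * (1 - p) ^ m"
      using least[of m] m by (simp add: P_def)
    then have "1 * (1 - (1 - p) ^ M) \<le> p * (\<gamma> * x + M) * (1 - p) ^ m"
      by (simp add: m algebra_simps)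
    also have "\<dots> = w * (1 - p) ^ m * (1 - (1 - p) ^ M)" using w by (simp add: mult_ac)
    finally show ?thesis using less by simp
  qed
  have w0: "0 < w" using wm p by (smt (verit) mult_nonpos_nonneg zero_le_power)
  have 4: "1 \<le> w * (1 - p) ^ i" if "i \<le> m" for i
  proof -
    have "w * (1 - p) ^ m \<le> w * (1 - p) ^ i"
      using w0 p that by (intro mult_left_mono power_decreasing) auto
    then show ?thesis using wm by simp
  qed
  show thesis by (rule that[OF 1 2 3 4])
qed

lemma omega_awgn_bounds:
  assumes "0 < \<gamma>" "0 < p" "p < 1" "0 \<le> x"
  shows "0 \<le> omega_awgn \<gamma> p x" "omega_awgn \<gamma> p x \<le> x"
proof -
  obtain m w where om: "omega_awgn \<gamma> p x = (w - 1) / \<gamma>"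
    and sum: "(\<Sum>i<Suc m. w * (1 - p) ^ i - 1) = \<gamma> * x"
    and ge: "\<And>i. i \<le> m \<Longrightarrow> 1 \<le> w * (1 - p) ^ i"
    using omega_awgn_water_filling[OF assms] by blast
  show "0 \<le> omega_awgn \<gamma> p x" using om ge[of 0] assms by simp
  have "w - 1 \<le> (\<Sum>i<Suc m. w * (1 - p) ^ i - 1)"
    using member_le_sum[of 0 "{..<Suc m}" "\<lambda>i. w * (1 - p) ^ i - 1"] ge by auto
  then have "w - 1 \<le> \<gamma> * x" using sum by simp
  then show "omega_awgn \<gamma> p x \<le> x" using om assms by (simp add: pos_divide_le_eq mult.commute)
qed

text \<open>Strong duality: the water-filling allocation \<open>v\<close> attains an affine majorant
  at \<open>x\<close>. Without its first slot, \<open>v\<close> is feasible for the remaining budget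
  with one factor \<open>1 - p\<close> taken out, which yields the Bellman inequality.\<close>

lemma discounted_value_le_omega_awgn:
  fixes \<gamma> p x :: real
  assumes \<gamma>: "0 < \<gamma>" and p: "0 < p" "p < 1" and x: "0 \<le> x"
  shows "discounted_value (awgn_reward \<gamma>) p x
    \<le> awgn_reward \<gamma> (omega_awgn \<gamma> p x)
      + (1 - p) * discounted_value (awgn_reward \<gamma>) p (x - omega_awgn \<gamma> p x)"
proof -
  let ?r = "awgn_reward \<gamma>"
  obtain m w where om: "omega_awgn \<gamma> p x = (w - 1) / \<gamma>"
    and sum: "(\<Sum>i<Suc m. w * (1 - p) ^ i - 1) = \<gamma> * x"
    and lt: "w * (1 - p) ^ Suc m < 1"
    and ge: "\<And>i. i \<le> m \<Longrightarrow> 1 \<le> w * (1 - p) ^ i"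
    using omega_awgn_water_filling[OF assms] by blast
  define v where "v i = (if i \<le> m then (w * (1 - p) ^ i - 1) / \<gamma> else 0)" for i
  \<comment> \<open>The multiplier is the common discounted marginal reward of all slots
    \<open>i \<le> m\<close>, because \<open>1 + \<gamma> * v i = w * (1 - p) ^ i\<close>
    there.\<close>
  define a where "a = \<gamma> / (2 * w)"
  define d where "d = (\<Sum>i<Suc m. (1 - p) ^ i * ?r (v i) - a * v i)"
  have w: "1 \<le> w" using ge[of 0] by simp
  have v0: "0 \<le> v i" for i using ge[of i] \<gamma> by (simp add: v_def)
  have sum_v: "(\<Sum>i<Suc m. v i) = x"
  proof -
    have "(\<Sum>i<Suc m. v i) = (\<Sum>i<Suc m. (w * (1 - p) ^ i - 1) / \<gamma>)"
      by (intro sum.cong) (auto simp: v_def)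
    also have "\<dots> = x" using sum \<gamma> by (simp add: sum_divide_distrib[symmetric] del: sum.lessThan_Suc)
    finally show ?thesis .
  qed
  have slot: "(1 - p) ^ i * ?r z \<le> (1 - p) ^ i * ?r (v i) + a * (z - v i)" if z: "0 \<le> z" for i z
  proof (cases "i \<le> m")
    case True
    have eq: "1 + \<gamma> * v i = w * (1 - p) ^ i" using True \<gamma> by (simp add: v_def)
    have "(1 - p) ^ i * ?r z \<le> (1 - p) ^ i * (?r (v i) + \<gamma> / (2 * (w * (1 - p) ^ i)) * (z - v i))"
      using awgn_reward_le_tangent[OF \<gamma> z v0[of i]] p unfolding eq by (intro mult_left_mono) auto
    also have "\<dots> = (1 - p) ^ i * ?r (v i) + a * (z - v i)"
      using p w by (simp add: a_def field_simps)
    finally show ?thesis .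
  next
    case False
    \<comment> \<open>In an empty slot the discounted marginal reward at 0 is at most
      \<open>a\<close>, since \<open>w * (1 - p) ^ Suc m < 1\<close>.\<close>
    have "(1 - p) ^ i \<le> (1 - p) ^ Suc m" using False p by (intro power_decreasing) auto
    then have "(1 - p) ^ i \<le> 1 / w" using lt w by (smt (verit) pos_le_divide_eq mult.commute)
    then have "(1 - p) ^ i * ?r z \<le> 1 / w * (\<gamma> / 2 * z)"
      using awgn_reward_le_linear[OF \<gamma> z] awgn_reward_nonneg[OF \<gamma> z] w by (intro mult_mono) auto
    then show ?thesis using False by (simp add: v_def a_def)
  qed
  \<comment> \<open>Nonnegative summands allow a sum over \<open>N\<close> slots to be extended
    beyond slot \<open>m\<close>, where they vanish.\<close>
  have gain: "0 \<le> (1 - p) ^ i * ?r (v i) - a * v i" for i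
    using slot[of 0 i] by simp
  have "affine_majorant ?r p a d"
    unfolding affine_majorant_def
  proof (intro conjI allI impI)
    fix N :: nat and u :: "nat \<Rightarrow> real" assume u: "\<forall>i. 0 \<le> u i"
    have "(\<Sum>i<N. (1 - p) ^ i * ?r (u i))
        \<le> (\<Sum>i<N. a * u i + ((1 - p) ^ i * ?r (v i) - a * v i))"
    proof (rule sum_mono)
      fix i
      show "(1 - p) ^ i * ?r (u i) \<le> a * u i + ((1 - p) ^ i * ?r (v i) - a * v i)"
        using slot[of "u i" i] u by (simp add: algebra_simps)
    qed
    also have "\<dots> = a * (\<Sum>i<N. u i) + (\<Sum>i<N. (1 - p) ^ i * ?r (v i) - a * v i)"
      by (simp add: sum.distrib sum_distrib_left)
    also have "(\<Sum>i<N. (1 - p) ^ i * ?r (v i) - a * v i)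
        \<le> (\<Sum>i<max N (Suc m). (1 - p) ^ i * ?r (v i) - a * v i)"
      using gain by (intro sum_mono2) auto
    also have "\<dots> = d"
      unfolding d_def by (intro sum.mono_neutral_right) (auto simp: v_def)
    finally show "(\<Sum>i<N. (1 - p) ^ i * ?r (u i)) \<le> a * (\<Sum>i<N. u i) + d" by simp
  qed (use \<gamma> w in \<open>simp add: a_def\<close>)
  from discounted_value_le[OF this x]
  have "discounted_value ?r p x \<le> a * (\<Sum>i<Suc m. v i) + d" using sum_v by simp
  also have "\<dots> = (\<Sum>i<Suc m. (1 - p) ^ i * ?r (v i))"
    by (simp add: d_def sum_subtractf sum_distrib_left del: sum.lessThan_Suc)
  also have "\<dots> = ?r (v 0) + (1 - p) * (\<Sum>i<m. (1 - p) ^ i * ?r (v (Suc i)))"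
    by (simp add: sum.lessThan_Suc_shift sum_distrib_left mult_ac del: sum.lessThan_Suc)
  also have "\<dots> \<le> ?r (v 0) + (1 - p) * discounted_value ?r p (x - v 0)"
  proof -
    have "(\<Sum>i<m. v (Suc i)) \<le> x - v 0"
      using sum_v by (simp add: sum.lessThan_Suc_shift del: sum.lessThan_Suc)
    then show ?thesis
      using p v0 by (intro add_left_mono mult_left_mono
          discounted_value_ge[OF affine_majorant_awgn_reward[OF \<gamma> p], of "\<lambda>i. v (Suc i)"]) auto
  qed
  also have "v 0 = omega_awgn \<gamma> p x" by (simp add: v_def om)
  finally show ?thesis .
qed

section \<open>Multiplicative factors\<close>

text \<open>Spends each arrival at once and so bounds the supremum over policies from below. The cap
  is for admissibility, which concerns arrivals above \<open>c\<close> as well.\<close>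

definition greedy_policy :: "real \<Rightarrow> policy" where
  "greedy_policy c t x = min (x t) c"

lemma consumed_greedy_policy: "consumed (greedy_policy c) x t = min (x t) c"
  by (simp add: consumed_def greedy_policy_def)

lemma greedy_policy_admissible:
  assumes "0 < c"
  shows "greedy_policy c \<in> admissible_policies c"
proof -
  have "greedy_policy c t \<in> borel_measurable (Pi\<^sub>M {..t} (\<lambda>_. restrict_space borel {0..}))" for t
  proof -
    have "(\<lambda>x. x t) \<in> measurable (Pi\<^sub>M {..t} (\<lambda>_. restrict_space borel {0..})) (restrict_space borel {0::real..})"
      by (rule measurable_component_singleton) simp
    then have "(\<lambda>x. x t) \<in> borel_measurable (Pi\<^sub>M {..t} (\<lambda>_. restrict_space borel {0::real..}))"
      using measurable_restrict_space2_iff by blast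
    then show ?thesis unfolding greedy_policy_def by simp
  qed
  moreover have "battery_before c (greedy_policy c) x t = 0" for x t
    by (induction t) (simp_all add: consumed_greedy_policy)
  ultimately show ?thesis
    using assms by (auto simp: admissible_policies_def consumed_greedy_policy battery_def)
qed

lemma borel_measurable_fixed_fraction: "fixed_fraction p \<in> borel_measurable borel"
  unfolding fixed_fraction_def by measurable

section \<open>Lower bounds on the factors for arbitrary arrival laws\<close>

context energy_arrivals
begin

lemma throughput_greedy:
  assumes r: "r \<in> borel_measurable borel" and r_le: "\<And>u. u \<in> {0..c} \<Longrightarrow> \<bar>r u\<bar> \<le> K"
  shows "throughput r (greedy_policy c) Q = ereal (\<integral>x. r x \<partial>Q)"
proof -
  have int_r: "integrable paths (\<lambda>x. r (x t))" for t
  proof (rule integrable_bounded[where B = K])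
    show "(\<lambda>x. r (x t)) \<in> borel_measurable paths"
      by (rule measurable_compose[OF borel_measurable_coordinate r]) simp
  qed (use r_le path_in in blast)
  have "(\<integral>x. 1 / real n * (\<Sum>t<n. r (consumed (greedy_policy c) x t)) \<partial>paths) = (\<integral>x. r x \<partial>Q)"
    if "n > 0" for n
  proof -
    have "(\<integral>x. 1 / real n * (\<Sum>t<n. r (consumed (greedy_policy c) x t)) \<partial>paths)
      = (\<integral>x. 1 / real n * (\<Sum>t<n. r (x t)) \<partial>paths)"
    proof (rule Bochner_Integration.integral_cong)
      fix x assume "x \<in> space paths"
      then have "min (x t) c = x t" for t using path_in[of x t] by auto
      then show "1 / real n * (\<Sum>t<n. r (consumed (greedy_policy c) x t)) = 1 / real n * (\<Sum>t<n. r (x t))"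
        by (simp add: consumed_greedy_policy)
    qed simp
    also have "\<dots> = (\<integral>x. r x \<partial>Q)"
      using that int_r by (simp add: integral_coordinate[OF r])
    finally show ?thesis .
  qed
  then have "throughput r (greedy_policy c) Q = liminf (\<lambda>n. ereal (\<integral>x. r x \<partial>Q))"
    unfolding throughput_def by (intro Liminf_eq eventually_sequentiallyI[of 1]) auto
  then show ?thesis by (simp add: Liminf_const)
qed

text \<open>The supremum in the denominator lies between 0 and
  \<open>awgn_reward \<gamma> (p * c)\<close>, hence is a real number, and a throughput bound
  relative to the latter passes to the quotient.\<close>

lemma mult_factor_awgn_ge:
  assumes \<gamma>: "0 < \<gamma>" and p: "0 < p" and \<alpha>: "0 < \<alpha>"
    and T: "ereal (\<alpha> * awgn_reward \<gamma> (p * c)) \<le> throughput (awgn_reward \<gamma>) \<pi> Q"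
  shows "ereal \<alpha> \<le> mult_factor (awgn_reward \<gamma>) c \<pi> Q"
proof -
  let ?r = "awgn_reward \<gamma>"
  define S where "S = (SUP \<pi>'\<in>admissible_policies c. throughput ?r \<pi>' Q)"
  define R where "R = ?r (p * c)"
  have R: "0 < R" using \<gamma> p c_pos by (simp add: R_def awgn_reward_pos)
  have "S \<le> ereal R"
    unfolding S_def R_def
  proof (rule SUP_least, rule throughput_le[where a = "\<gamma> / (2 * (1 + \<gamma> * (p * c)))"])
    show "?r u \<le> ?r (p * c) + \<gamma> / (2 * (1 + \<gamma> * (p * c))) * (u - p * c)" if "u \<in> {0..c}" for u
      using awgn_reward_le_tangent[OF \<gamma>, of u "p * c"] that p c_pos by simp
    show "\<bar>?r u\<bar> \<le> \<gamma> / 2 * c" if "u \<in> {0..c}" for u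
      using that by (rule awgn_reward_abs_le[OF \<gamma>])
  qed (use \<gamma> p c_pos in auto)
  moreover have "0 \<le> S"
  proof -
    have "0 \<le> (\<integral>x. ?r x \<partial>Q)"
      by (intro integral_nonneg_AE AE_I2) (auto simp: space_Q awgn_reward_nonneg \<gamma>)
    then have "0 \<le> throughput ?r (greedy_policy c) Q"
      using throughput_greedy[OF borel_measurable_awgn_reward awgn_reward_abs_le[OF \<gamma>, of _ c]]
      by simp
    also have "\<dots> \<le> S"
      unfolding S_def by (rule SUP_upper) (rule greedy_policy_admissible[OF c_pos])
    finally show ?thesis .
  qed
  ultimately obtain s where s: "S = ereal s" "0 \<le> s" "s \<le> R"
    by (cases S) auto
  have \<alpha>R: "0 < \<alpha> * R" using \<alpha> R by simp
  have "ereal \<alpha> \<le> throughput ?r \<pi> Q / S"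
  \<comment> \<open>In \<open>ereal\<close>, a positive throughput divided by 0 is infinite, so the
    bound holds in this case too.\<close>
  proof (cases "s = 0")
    case True
    then show ?thesis
      using T \<alpha>R s by (cases "throughput ?r \<pi> Q") (auto simp: R_def[symmetric])
  next
    case False
    have "\<alpha> * s \<le> \<alpha> * R" using s \<alpha> by simp
    then have "ereal s * ereal \<alpha> \<le> throughput ?r \<pi> Q"
      using order_trans[OF _ T, of "ereal (\<alpha> * s)"] by (simp add: R_def mult.commute[of s])
    then show ?thesis using s False by (subst ereal_le_divide_pos) auto
  qed
  then show ?thesis by (simp add: mult_factor_def S_def)
qed

text \<open>With \<open>h\<close> the clamped discounted value and gain \<open>p * ?V c\<close>, the
  drift condition reduces to \<open>discounted_value_le_omega_awgn\<close>.\<close>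

lemma mult_factor_omega_awgn_ge:
  assumes \<gamma>: "0 < \<gamma>" and p: "0 < p" "p < 1"
  shows "ereal (1 - exp (-1)) \<le> mult_factor (awgn_reward \<gamma>) c (stationary_policy c (omega_awgn \<gamma> p)) Q"
proof (rule mult_factor_awgn_ge[OF \<gamma> p(1)])
  let ?V = "discounted_value (awgn_reward \<gamma>) p" and ?\<omega> = "omega_awgn \<gamma> p"
  note major = affine_majorant_awgn_reward[OF \<gamma> p]
  have "ereal ((1 - exp (-1)) * awgn_reward \<gamma> (p * c)) \<le> ereal (p * ?V c)"
    using discounted_value_ge_constant_allocation[OF \<gamma> p c_pos] by simp
  also have "\<dots> \<le> throughput (awgn_reward \<gamma>) (stationary_policy c ?\<omega>) Q"
  proof (rule throughput_stationary_ge[where h = "\<lambda>b. ?V (max 0 b)"])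
    show "mono (\<lambda>b. ?V (max 0 b))" by (rule mono_discounted_value[OF major])
    have "concave_on {0..c} ?V"
      using convex_on_subset[OF concave_discounted_value[OF major, unfolded concave_on_def]]
      by (auto simp: concave_on_def)
    then show "concave_on {0..c} (\<lambda>b. ?V (max 0 b))"
      unfolding concave_on_iff by (auto simp: max_absorb2)
    fix b assume b: "b \<in> {0..c}"
    then show "0 \<le> ?\<omega> b \<and> ?\<omega> b \<le> b" using omega_awgn_bounds[OF \<gamma> p] by auto
    then show "?V (max 0 b) + p * ?V c
        \<le> awgn_reward \<gamma> (?\<omega> b) + (1 - p) * ?V (max 0 (b - ?\<omega> b)) + p * ?V (max 0 c)"
      using discounted_value_le_omega_awgn[OF \<gamma> p, of b] b c_pos by (auto simp: max_absorb2)
  qed (auto intro: awgn_reward_abs_le[OF \<gamma>] borel_measurable_omega_awgn)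
  finally show "ereal ((1 - exp (-1)) * awgn_reward \<gamma> (p * c))
      \<le> throughput (awgn_reward \<gamma>) (stationary_policy c ?\<omega>) Q" .
qed simp

lemma mult_factor_fixed_fraction_ge:
  assumes \<gamma>: "0 < \<gamma>" and p: "0 < p" "p < 1"
  shows "ereal (1 / (2 - p)) \<le> mult_factor (awgn_reward \<gamma>) c (stationary_policy c (fixed_fraction p)) Q"
proof (rule mult_factor_awgn_ge[OF \<gamma> p(1)])
  define R where "R = awgn_reward \<gamma> (p * c)"
  \<comment> \<open>With this slope the drift condition for \<open>A * b\<close> reduces to the
    chord bound \<open>b / c * R \<le> awgn_reward \<gamma> (p * b)\<close>.\<close>
  define A where "A = R / (c * p * (2 - p))"
  have R: "0 \<le> R" using \<gamma> p c_pos by (simp add: R_def awgn_reward_nonneg)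
  have A: "0 \<le> A" using R p c_pos by (simp add: A_def)
  have RA: "R = A * (c * p * (2 - p))" using p c_pos by (simp add: A_def)
  show "ereal (1 / (2 - p) * awgn_reward \<gamma> (p * c))
      \<le> throughput (awgn_reward \<gamma>) (stationary_policy c (fixed_fraction p)) Q"
  proof (rule throughput_stationary_ge[where h = "\<lambda>b. A * b"])
    show "mono (\<lambda>b. A * b)" using A by (auto intro: monoI mult_left_mono)
    show "concave_on {0..c} (\<lambda>b. A * b)"
      by (auto simp: concave_on_iff algebra_simps)
    fix b assume b: "b \<in> {0..c}"
    then show "0 \<le> fixed_fraction p b \<and> fixed_fraction p b \<le> b"
      using p by (auto simp: fixed_fraction_def mult_left_le_one_le)
    have "b / c * R \<le> awgn_reward \<gamma> (fixed_fraction p b)"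
      using awgn_reward_scale[OF \<gamma>, of "p * c" "b / c"] p c_pos b
      by (simp add: R_def fixed_fraction_def mult.commute)
    moreover have "b / c * R = A * b * p * (2 - p)" using c_pos by (simp add: RA)
    moreover have "1 / (2 - p) * R = A * c * p" using p by (simp add: RA)
    moreover have "(1 - p) * (A * (b - fixed_fraction p b)) = A * b - A * b * p * (2 - p)"
      by (simp add: fixed_fraction_def algebra_simps)
    moreover have "p * (A * c) = A * c * p" by simp
    ultimately show "A * b + 1 / (2 - p) * awgn_reward \<gamma> (p * c)
        \<le> awgn_reward \<gamma> (fixed_fraction p b) + (1 - p) * (A * (b - fixed_fraction p b)) + p * (A * c)"
      unfolding R_def by linarith
  qed (auto intro: awgn_reward_abs_le[OF \<gamma>] borel_measurable_fixed_fraction)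
qed (use p in simp)

end

section \<open>Bernoulli arrivals\<close>

definition bernoulli_law :: "real \<Rightarrow> real \<Rightarrow> real measure" where
  "bernoulli_law c p =
     distr (measure_pmf (bernoulli_pmf p)) (restrict_space borel {0..c}) (\<lambda>b. if b then c else 0)"

lemma measurable_bernoulli_law:
  "0 < c \<Longrightarrow> (\<lambda>b. if b then c else 0)
     \<in> measurable (measure_pmf (bernoulli_pmf p)) (restrict_space borel {0..c::real})"
  by (auto simp: measurable_def space_restrict_space)

lemma integral_bernoulli_law:
  fixes f :: "real \<Rightarrow> real"
  assumes "0 < c" "0 < p" "p < 1" "f \<in> borel_measurable borel"
  shows "(\<integral>x. f x \<partial>bernoulli_law c p) = p * f c + (1 - p) * f 0"
  unfolding bernoulli_law_def
  using assms by (subst integral_distr[OF measurable_bernoulli_law])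
    (auto intro: measurable_restrict_space1)

lemma bernoulli_law_in_arrival_laws:
  assumes "0 < c" "0 < p" "p < 1"
  shows "bernoulli_law c p \<in> arrival_laws c p"
proof -
  have "prob_space (bernoulli_law c p)"
    unfolding bernoulli_law_def
    by (rule prob_space.prob_space_distr[OF prob_space_measure_pmf measurable_bernoulli_law[OF assms(1)]])
  then show ?thesis
    using assms integral_bernoulli_law[OF assms, of "\<lambda>x. x"]
    by (simp add: arrival_laws_def) (simp add: bernoulli_law_def)
qed

lemma AE_bernoulli_law:
  assumes "0 < c"
  shows "AE x in bernoulli_law c p. x \<in> {0, c}"
proof -
  have "{x \<in> space (restrict_space borel {0..c}). x \<in> {0, c}} \<in> sets (restrict_space borel {0..c})"
    using assms by (auto simp: sets_restrict_space space_restrict_space intro!: image_eqI[of _ _ "{0, c}"])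
  then show ?thesis
    unfolding bernoulli_law_def by (subst AE_distr_iff[OF measurable_bernoulli_law[OF assms]]) auto
qed

text \<open>The mean level obeys an affine recursion with factor \<open>(1 - p)\<^sup>2\<close>,
  increment \<open>p * c\<close> and fixed point \<open>c / (2 - p)\<close>, below which it starts
  and stays. The tangent at 0 bounds the reward.\<close>

lemma throughput_fixed_fraction_bernoulli_le:
  assumes \<gamma>: "0 < \<gamma>" and c: "0 < c" and p: "0 < p" "p < 1"
  shows "throughput (awgn_reward \<gamma>) (stationary_policy c (fixed_fraction p)) (bernoulli_law c p)
    \<le> ereal (\<gamma> / 2 * (p * (c / (2 - p))))"
proof -
  interpret energy_arrivals c p "bernoulli_law c p"
    using c bernoulli_law_in_arrival_laws[OF c p] by unfold_locales
  define b where "b t x = stationary_battery c (fixed_fraction p) x t" for t x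
  note \<phi> = borel_measurable_fixed_fraction[of p]
  have b_in: "b t x \<in> {0..c}" if "x \<in> space paths" for t x
    using stationary_battery_in[OF _ that, of "fixed_fraction p" t] p
    by (auto simp: b_def fixed_fraction_def mult_left_le_one_le)
  have bm[measurable]: "b t \<in> borel_measurable paths" for t
    unfolding b_def by (rule borel_measurable_stationary_battery[OF \<phi>]) simp
  have xm[measurable]: "(\<lambda>x. x t) \<in> borel_measurable paths" for t
    by (rule borel_measurable_coordinate) simp
  have int_b: "integrable paths (b t)" for t
    by (rule integrable_bounded[where B = c]) (use b_in in force)+
  have int_bx: "integrable paths (\<lambda>x. b t x * x (Suc t))" for t
  proof (rule integrable_bounded[where B = "c * c"])
    show "\<bar>b t x * x (Suc t)\<bar> \<le> c * c" if "x \<in> space paths" for x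
      unfolding abs_mult using b_in[OF that, of t] path_in[OF that, of "Suc t"]
      by (intro mult_mono) auto
  qed simp
  have prod: "(\<integral>x. b t x * x (Suc t) \<partial>paths) = p * c * (\<integral>x. b t x \<partial>paths)" for t
    unfolding b_def
    by (rule expectation_battery_times_next[OF \<phi>, of "\<lambda>y. y" _ c])
      (use b_in in \<open>force simp: b_def\<close>)+
  have E: "(\<integral>x. b t x \<partial>paths) \<le> c / (2 - p)" for t
  proof (induction t)
    case 0
    have "(\<integral>x. b 0 x \<partial>paths) \<le> (\<integral>x. x 0 \<partial>paths)"
      using int_b[of 0] integrable_arrival[of 0] by (intro integral_mono) (auto simp: b_def)
    also have "\<dots> = c / (2 - p) * (p * (2 - p))" using p by (simp add: mean_arrival)
    also have "\<dots> \<le> c / (2 - p) * 1"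
    proof (rule mult_left_mono)
      have "p * (2 - p) = 1 - (1 - p) ^ 2" by (simp add: power2_eq_square algebra_simps)
      then show "p * (2 - p) \<le> 1" by simp
    qed (use c p in simp)
    finally show ?case by simp
  next
    case (Suc t)
    have "AE x in paths. x (Suc t) \<in> {0, c}"
      using AE_PiM_component[of UNIV "\<lambda>_. bernoulli_law c p" "Suc t" "\<lambda>y. y \<in> {0, c}"]
        AE_bernoulli_law[OF c] arrival.prob_space_axioms by simp
    \<comment> \<open>For arrivals 0 and \<open>c\<close> the capped sum agrees with a bilinear
      expression in level and arrival, whose expectation follows from independence.\<close>
    then have "AE x in paths. b (Suc t) x = (1 - p) * b t x + x (Suc t) - (1 - p) / c * (b t x * x (Suc t))"
    proof (rule AE_mp, intro AE_I2 impI)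
      fix x assume "x \<in> space paths" "x (Suc t) \<in> {0, c}"
      moreover from this have "0 \<le> (1 - p) * b t x" "(1 - p) * b t x \<le> c"
        using b_in[of x t] p c mult_left_le_one_le[of "b t x" "1 - p"] by auto
      moreover have "b (Suc t) x = min ((1 - p) * b t x + x (Suc t)) c"
        by (simp add: b_def fixed_fraction_def algebra_simps)
      ultimately show "b (Suc t) x = (1 - p) * b t x + x (Suc t) - (1 - p) / c * (b t x * x (Suc t))"
        using c by auto
    qed
    then have "(\<integral>x. b (Suc t) x \<partial>paths)
        = (\<integral>x. (1 - p) * b t x + x (Suc t) - (1 - p) / c * (b t x * x (Suc t)) \<partial>paths)"
      by (intro integral_cong_AE) measurable
    also have "\<dots> = (1 - p) * (\<integral>x. b t x \<partial>paths) + p * c - (1 - p) / c * (p * c * (\<integral>x. b t x \<partial>paths))"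
      using int_b int_bx integrable_arrival by (simp add: prod mean_arrival)
    also have "\<dots> = (1 - p)\<^sup>2 * (\<integral>x. b t x \<partial>paths) + p * c"
    proof -
      have "(1 - p) / c * (p * c * z) = (1 - p) * (p * z)" for z using c by simp
      then show ?thesis by (simp only:) (simp add: power2_eq_square algebra_simps)
    qed
    also have "\<dots> \<le> (1 - p)\<^sup>2 * (c / (2 - p)) + p * c"
      using Suc by (intro add_right_mono mult_left_mono) auto
    also have "\<dots> = c / (2 - p)"
      using p by (simp add: field_simps power2_eq_square)
    finally show ?case .
  qed
  have int_r: "integrable paths (\<lambda>x. awgn_reward \<gamma> (p * b t x))" for t
  proof (rule integrable_bounded[where B = "\<gamma> / 2 * c"])
    show "\<bar>awgn_reward \<gamma> (p * b t x)\<bar> \<le> \<gamma> / 2 * c" if "x \<in> space paths" for x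
      using b_in[OF that, of t] p mult_left_le_one_le[of "b t x" p]
      by (intro awgn_reward_abs_le \<gamma>) auto
  qed measurable
  have reward_le: "(\<integral>x. awgn_reward \<gamma> (p * b t x) \<partial>paths) \<le> \<gamma> / 2 * (p * (c / (2 - p)))" for t
  proof -
    have "(\<integral>x. awgn_reward \<gamma> (p * b t x) \<partial>paths) \<le> (\<integral>x. \<gamma> / 2 * (p * b t x) \<partial>paths)"
      using int_r int_b b_in p by (intro integral_mono awgn_reward_le_linear \<gamma>) auto
    also have "\<dots> = \<gamma> / 2 * (p * (\<integral>x. b t x \<partial>paths))" by simp
    also have "\<dots> \<le> \<gamma> / 2 * (p * (c / (2 - p)))"
      using E \<gamma> p by (intro mult_left_mono) auto
    finally show ?thesis .
  qed
  let ?g = "\<gamma> / 2 * (p * (c / (2 - p)))"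
  have "(\<integral>x. 1 / real n * (\<Sum>t<n. awgn_reward \<gamma> (consumed (stationary_policy c (fixed_fraction p)) x t)) \<partial>paths)
      \<le> ?g" if "n > 0" for n
  proof -
    have "(\<integral>x. 1 / real n * (\<Sum>t<n. awgn_reward \<gamma> (consumed (stationary_policy c (fixed_fraction p)) x t)) \<partial>paths)
      = 1 / real n * (\<Sum>t<n. \<integral>x. awgn_reward \<gamma> (p * b t x) \<partial>paths)"
      using int_r by (simp add: consumed_stationary_policy b_def fixed_fraction_def)
    also have "\<dots> \<le> 1 / real n * (\<Sum>t<n. ?g)"
      by (intro mult_left_mono sum_mono reward_le) simp
    also have "\<dots> = ?g" using that by simp
    finally show ?thesis .
  qed
  then have "throughput (awgn_reward \<gamma>) (stationary_policy c (fixed_fraction p)) (bernoulli_law c p)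
      \<le> liminf (\<lambda>n. ereal ?g)"
    unfolding throughput_def by (intro Liminf_mono eventually_sequentiallyI[of 1]) auto
  then show ?thesis by (simp add: Liminf_const)
qed

text \<open>The greedy policy earns \<open>p * awgn_reward \<gamma> c\<close>, a positive lower
  bound for the denominator; the factor \<open>p\<close> cancels.\<close>

lemma mult_factor_fixed_fraction_bernoulli_le:
  assumes \<gamma>: "0 < \<gamma>" and c: "0 < c" and p: "0 < p" "p < 1"
  shows "mult_factor (awgn_reward \<gamma>) c (stationary_policy c (fixed_fraction p)) (bernoulli_law c p)
    \<le> ereal (\<gamma> * c / ((2 - p) * ln (1 + \<gamma> * c)))"
proof -
  interpret energy_arrivals c p "bernoulli_law c p"
    using c bernoulli_law_in_arrival_laws[OF c p] by unfold_locales
  let ?r = "awgn_reward \<gamma>" and ?g = "\<gamma> / 2 * (p * (c / (2 - p)))"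
  define S where "S = (SUP \<pi>'\<in>admissible_policies c. throughput ?r \<pi>' (bernoulli_law c p))"
  have pos: "0 < p * ?r c" using \<gamma> c p by (simp add: awgn_reward_pos)
  have "ereal (p * ?r c) = throughput ?r (greedy_policy c) (bernoulli_law c p)"
    using throughput_greedy[OF borel_measurable_awgn_reward awgn_reward_abs_le[OF \<gamma>, of _ c]]
      integral_bernoulli_law[OF c p borel_measurable_awgn_reward] by simp
  also have "\<dots> \<le> S"
    unfolding S_def by (rule SUP_upper) (rule greedy_policy_admissible[OF c])
  finally have S: "ereal (p * ?r c) \<le> S" .
  then have S_pos: "0 < S" using pos by (metis ereal_less(2) less_le_trans)
  have "throughput ?r (stationary_policy c (fixed_fraction p)) (bernoulli_law c p) / S \<le> ereal ?g / S"
    by (rule ereal_divide_right_mono[OF throughput_fixed_fraction_bernoulli_le[OF assms] S_pos])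
  also have "\<dots> \<le> ereal ?g / ereal (p * ?r c)"
    using \<gamma> c p pos S S_pos by (intro ereal_divide_left_mono) (auto simp: ereal_zero_less_0_iff)
  also have "\<dots> = ereal (\<gamma> * c / ((2 - p) * ln (1 + \<gamma> * c)))"
    using \<gamma> c p pos by (auto simp: awgn_reward_def field_simps)
  finally show ?thesis by (simp add: mult_factor_def S_def)
qed

section \<open>Infimum over all capacities, means and laws\<close>

theorem theorem28:
  fixes \<gamma> :: real
  assumes "\<gamma> > 0"
  shows "lower_mult_factor (awgn_reward \<gamma>) (\<lambda>c p. stationary_policy c (omega_awgn \<gamma> p))
           \<ge> ereal (1 - exp (-1)) \<and>
         lower_mult_factor (awgn_reward \<gamma>) (\<lambda>c p. stationary_policy c (fixed_fraction p))
           = ereal (1 / 2)"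
proof (intro conjI antisym)
  show "ereal (1 - exp (-1))
      \<le> lower_mult_factor (awgn_reward \<gamma>) (\<lambda>c p. stationary_policy c (omega_awgn \<gamma> p))"
    unfolding lower_mult_factor_def
    using energy_arrivals.mult_factor_omega_awgn_ge[OF energy_arrivals.intro assms]
    by (auto intro!: INF_greatest)
  have half: "ereal (1 / 2) \<le> mult_factor (awgn_reward \<gamma>) c (stationary_policy c (fixed_fraction p)) Q"
    if "0 < c" "0 < p" "p < 1" "Q \<in> arrival_laws c p" for c p Q
  proof -
    have "ereal (1 / 2) \<le> ereal (1 / (2 - p))" using that by (simp add: field_simps)
    also note energy_arrivals.mult_factor_fixed_fraction_ge[OF energy_arrivals.intro assms]
    finally show ?thesis using that by blast
  qed
  then show "ereal (1 / 2)
      \<le> lower_mult_factor (awgn_reward \<gamma>) (\<lambda>c p. stationary_policy c (fixed_fraction p))"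
    unfolding lower_mult_factor_def by (auto intro!: INF_greatest)
  \<comment> \<open>One sequence serves as both \<open>c\<close> and \<open>p\<close>: as it tends
    to 0, \<open>\<gamma> * c / ln (1 + \<gamma> * c)\<close> tends to 1 and \<open>2 - p\<close> to
    2. The offset 2 keeps it below 1 even at \<open>n = 0\<close>.\<close>
  define e where "e n = 1 / (real n + 2)" for n
  have e: "0 < e n" "e n < 1" for n by (auto simp: e_def)
  have "lower_mult_factor (awgn_reward \<gamma>) (\<lambda>c p. stationary_policy c (fixed_fraction p))
      \<le> ereal (\<gamma> * e n / ((2 - e n) * ln (1 + \<gamma> * e n)))" for n
    unfolding lower_mult_factor_def
  proof (rule INF_lower2[of "(e n, e n)"], goal_cases)
    case 2
    have "(INF Q\<in>arrival_laws (e n) (e n). mult_factor (awgn_reward \<gamma>) (e n)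
        (stationary_policy (e n) (fixed_fraction (e n))) Q)
      \<le> ereal (\<gamma> * e n / ((2 - e n) * ln (1 + \<gamma> * e n)))"
      by (rule INF_lower2) (rule bernoulli_law_in_arrival_laws
          mult_factor_fixed_fraction_bernoulli_le assms e)+
    then show ?case by simp
  qed (use e in auto)
  moreover have "(\<lambda>n. \<gamma> * e n / ((2 - e n) * ln (1 + \<gamma> * e n))) \<longlonglongrightarrow> 1 / 2"
    unfolding e_def using assms by real_asymp
  ultimately show "lower_mult_factor (awgn_reward \<gamma>) (\<lambda>c p. stationary_policy c (fixed_fraction p))
      \<le> ereal (1 / 2)"
    by (intro LIMSEQ_le_const[where X = "\<lambda>n. ereal (\<gamma> * e n / ((2 - e n) * ln (1 + \<gamma> * e n)))"]) auto
qed

end
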